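(* Let $H$ be the 3-dimensional complex $\omega$-Lie superalgebra with homogeneous basis $x_1,x_2\in H_{\bar 0}$, $y\in H_{\bar 1}$ and $[x_1,x_2]=x_1$, $[x_1,y]=y$, $[x_2,y]=[y,y]=0$, $\omega(x_1,x_2)=1$, $\omega(y,y)=0$. For any $d\in\mathrm{GDer}^{\omega}(H)$, the Jordan standard form of $d$ is one of the following: $$(1)\ \begin{pmatrix}a&0&0\\0&-a&0\\0&0&b\end{pmatrix};\quad (2)\ \begin{pmatrix}a&0&0\\1&a&0\\0&0&-a\end{pmatrix};\quad (3)\ \begin{pmatrix}0&0&0\\1&0&0\\0&0&c\end{pmatrix};\quad (4)\ \begin{pmatrix}0&0&0\\1&0&0\\0&1&0\end{pmatrix},$$ where $a,b,c\in\mathbb{C}$, $c\neq 0$.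
   Context: An $\omega$-Lie superalgebra over $\mathbb{C}$ is a $\mathbb{Z}_2$-graded vector space $g=g_{\bar 0}\oplus g_{\bar 1}$ with a bilinear bracket $[\cdot,\cdot]:g\times g\to g$ and a bilinear form $\omega:g\times g\to\mathbb{C}$ such that, for all $\alpha,\beta\in\mathbb{Z}_2$ and all homogeneous $x,y,z\in g$ (with $|x|\in\mathbb{Z}_2$ the degree of $x$): (1) $[g_\alpha,g_\beta]\subseteq g_{\alpha+\beta}$; (2) $[x,y]=-(-1)^{|x||y|}[y,x]$; (3) $(-1)^{|x||y|}[[y,z],x]+(-1)^{|y||z|}[[z,x],y]+(-1)^{|x||z|}[[x,y],z]=(-1)^{|x||y|}\omega(y,z)x+(-1)^{|y||z|}\omega(z,x)y+(-1)^{|x||z|}\omega(x,y)z$; (4) $\omega(g_{\bar 0},g_{\bar 1})=0$. For $H$, brackets of basis vectors not listed are determined by (2), and values of $\omega$ not listed are determined by (3) and (4): $\omega(x_2,x_1)=-1$, $\omega(x_1,x_1)=\omega(x_2,x_2)=0$, $\omega(x_i,y)=\omega(y,x_i)=0$. All conditions are for homogeneous $x\in g$ and all $y\in g$. A homogeneous linear map $d:g\to g$ of degree $|d|$ is a generalized derivation if there are linear maps $d',d''$ homogeneous of degree $|d|$ with $d''([x,y])=[d(x),y]+(-1)^{|d||x|}[x,d'(y)]$; it is compatible if $\omega(d(x),y)+(-1)^{|d||x|}\omega(x,d(y))=0$. $\mathrm{GDer}^{\omega}(g)$ is the graded subspace of $\mathrm{End}(g)$ spanned by the compatible homogeneous generalized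 derivations (so its elements need not be homogeneous). The Jordan standard form is that of $d$ as a linear endomorphism of the underlying 3-dimensional complex vector space, with ones below the diagonal, up to the order of the Jordan blocks. *)

theory Defs
  imports
    Complex_Main
    "HOL-Library.Z2"
    "HOL-Library.Function_Algebras"
    "HOL-Library.Product_Plus"
    "Jordan_Normal_Form.Jordan_Normal_Form"
begin

section \<open>Omega-Lie superalgebras\<close>

text \<open>Degrees are elements of the two-element field \<^typ>\<open>bit\<close>.  For degrees \<open>a\<close> and \<open>b\<close> the number
  \<open>koszul a b\<close> is the sign $(-1)^{ab}$.\<close>

definition koszul :: "bit \<Rightarrow> bit \<Rightarrow> complex" where
  "koszul a b = (if a * b = 1 then - 1 else 1)"

definition bilinear_map ::
  "(complex \<Rightarrow> 'v::ab_group_add \<Rightarrow> 'v) \<Rightarrow> (complex \<Rightarrow> 'w::ab_group_add \<Rightarrow> 'w) \<Rightarrow> ('v \<Rightarrow> 'v \<Rightarrow> 'w) \<Rightarrow> bool"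
  where
  "bilinear_map s t B \<longleftrightarrow>
     (\<forall>x. Vector_Spaces.linear s t (B x)) \<and> (\<forall>y. Vector_Spaces.linear s t (\<lambda>x. B x y))"

text \<open>The underlying vector space is the whole type \<open>'v\<close>, with scalar multiplication \<open>scale\<close>;
  \<open>g \<alpha>\<close> is the homogeneous component of degree \<open>\<alpha>\<close>.\<close>

locale omega_Lie_superalgebra = vector_space scale
  for scale :: "complex \<Rightarrow> 'v::ab_group_add \<Rightarrow> 'v" +
  fixes g :: "bit \<Rightarrow> 'v set"
    and br :: "'v \<Rightarrow> 'v \<Rightarrow> 'v"
    and \<omega> :: "'v \<Rightarrow> 'v \<Rightarrow> complex"
  assumes subspace_component: "subspace (g \<alpha>)"
    and components_disjoint: "g 0 \<inter> g 1 = {0}"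
    and components_sum: "\<exists>u\<in>g 0. \<exists>v\<in>g 1. x = u + v"
    and bilinear_bracket: "bilinear_map scale scale br"
    and bilinear_form: "bilinear_map scale (*) \<omega>"
    and bracket_degree: "x \<in> g \<alpha> \<Longrightarrow> y \<in> g \<beta> \<Longrightarrow> br x y \<in> g (\<alpha> + \<beta>)"
    and super_skew: "x \<in> g \<alpha> \<Longrightarrow> y \<in> g \<beta> \<Longrightarrow> br x y = - scale (koszul \<alpha> \<beta>) (br y x)"
    and omega_Jacobi: "x \<in> g \<alpha> \<Longrightarrow> y \<in> g \<beta> \<Longrightarrow> z \<in> g \<gamma> \<Longrightarrow>
        scale (koszul \<alpha> \<beta>) (br (br y z) x)
      + scale (koszul \<beta> \<gamma>) (br (br z x) y)
      + scale (koszul \<alpha> \<gamma>) (br (br x y) z)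
      = scale (koszul \<alpha> \<beta> * \<omega> y z) x
      + scale (koszul \<beta> \<gamma> * \<omega> z x) y
      + scale (koszul \<alpha> \<gamma> * \<omega> x y) z"
    and omega_even_odd: "x \<in> g 0 \<Longrightarrow> y \<in> g 1 \<Longrightarrow> \<omega> x y = 0"

section \<open>Compatible generalized derivations\<close>

definition homogeneous_map ::
  "(complex \<Rightarrow> 'v::ab_group_add \<Rightarrow> 'v) \<Rightarrow> (bit \<Rightarrow> 'v set) \<Rightarrow> bit \<Rightarrow> ('v \<Rightarrow> 'v) \<Rightarrow> bool" where
  "homogeneous_map scale g \<delta> d \<longleftrightarrow>
     Vector_Spaces.linear scale scale d \<and> (\<forall>\<alpha>. \<forall>x\<in>g \<alpha>. d x \<in> g (\<delta> + \<alpha>))"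

definition generalized_derivation ::
  "(complex \<Rightarrow> 'v::ab_group_add \<Rightarrow> 'v) \<Rightarrow> (bit \<Rightarrow> 'v set) \<Rightarrow> ('v \<Rightarrow> 'v \<Rightarrow> 'v) \<Rightarrow>
   bit \<Rightarrow> ('v \<Rightarrow> 'v) \<Rightarrow> bool" where
  "generalized_derivation scale g br \<delta> d \<longleftrightarrow>
     homogeneous_map scale g \<delta> d \<and>
     (\<exists>d' d''. homogeneous_map scale g \<delta> d' \<and> homogeneous_map scale g \<delta> d'' \<and>
        (\<forall>\<alpha>. \<forall>x\<in>g \<alpha>. \<forall>y.
           d'' (br x y) = br (d x) y + scale (koszul \<delta> \<alpha>) (br x (d' y))))"

definition omega_compatible ::
  "(bit \<Rightarrow> 'v set) \<Rightarrow> ('v \<Rightarrow> 'v \<Rightarrow> complex) \<Rightarrow> bit \<Rightarrow> ('v \<Rightarrow> 'v) \<Rightarrow> bool" where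
  "omega_compatible g \<omega> \<delta> d \<longleftrightarrow>
     (\<forall>\<alpha>. \<forall>x\<in>g \<alpha>. \<forall>y. \<omega> (d x) y + koszul \<delta> \<alpha> * \<omega> x (d y) = 0)"

text \<open>The span is taken in the space of all functions \<open>'v \<Rightarrow> 'v\<close> with pointwise operations;
  since the generators are linear, it lies in the space of linear endomorphisms.\<close>

definition GDer_omega ::
  "(complex \<Rightarrow> 'v::ab_group_add \<Rightarrow> 'v) \<Rightarrow> (bit \<Rightarrow> 'v set) \<Rightarrow> ('v \<Rightarrow> 'v \<Rightarrow> 'v) \<Rightarrow>
   ('v \<Rightarrow> 'v \<Rightarrow> complex) \<Rightarrow> ('v \<Rightarrow> 'v) set" where
  "GDer_omega scale g br \<omega> =
     module.span (\<lambda>c f x. scale c (f x))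
       {d. \<exists>\<delta>. generalized_derivation scale g br \<delta> d \<and> omega_compatible g \<omega> \<delta> d}"

section \<open>Jordan standard form of an endomorphism\<close>

definition ordered_basis :: "(complex \<Rightarrow> 'v::ab_group_add \<Rightarrow> 'v) \<Rightarrow> 'v list \<Rightarrow> bool" where
  "ordered_basis scale bs \<longleftrightarrow>
     distinct bs \<and> \<not> module.dependent scale (set bs) \<and> module.span scale (set bs) = UNIV"

text \<open>Column \<open>j\<close> holds the coordinates of the image of the \<open>j\<close>-th basis vector.\<close>

definition matrix_wrt ::
  "(complex \<Rightarrow> 'v::ab_group_add \<Rightarrow> 'v) \<Rightarrow> 'v list \<Rightarrow> ('v \<Rightarrow> 'v) \<Rightarrow> complex mat" where
  "matrix_wrt scale bs d =
     mat (length bs) (length bs)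
       (\<lambda>(i, j). module.representation scale (set bs) (d (bs ! j)) (bs ! i))"

text \<open>\<^const>\<open>jordan_matrix\<close> has ones above the diagonal; its transpose is the block diagonal matrix
  with the same sequence of blocks, with ones below the diagonal.\<close>

definition lower_jordan_matrix :: "complex mat \<Rightarrow> bool" where
  "lower_jordan_matrix J \<longleftrightarrow>
     (\<exists>n_as. 0 \<notin> fst ` set n_as \<and> J = transpose_mat (jordan_matrix n_as))"

text \<open>As the order of the blocks is not prescribed, this is a relation: \<open>J\<close> is determined by \<open>d\<close> only
  up to permuting its blocks.\<close>

definition jordan_standard_form ::
  "(complex \<Rightarrow> 'v::ab_group_add \<Rightarrow> 'v) \<Rightarrow> ('v \<Rightarrow> 'v) \<Rightarrow> complex mat \<Rightarrow> bool" where
  "jordan_standard_form scale d J \<longleftrightarrow>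
     lower_jordan_matrix J \<and> (\<exists>bs. ordered_basis scale bs \<and> matrix_wrt scale bs d = J)"

section \<open>Consistency of the structure constants\<close>

text \<open>The hypotheses imposed on $H$ are satisfiable; here on the type of triples of complex
  numbers, $(a,b,c)$ standing for $a x_1 + b x_2 + c y$.\<close>

lemma H_exists:
  "\<exists>scale g br \<omega> (x1 :: complex \<times> complex \<times> complex) x2 y.
     omega_Lie_superalgebra scale g br \<omega> \<and> ordered_basis scale [x1, x2, y] \<and>
     x1 \<in> g 0 \<and> x2 \<in> g 0 \<and> y \<in> g 1 \<and>
     br x1 x2 = x1 \<and> br x1 y = y \<and> br x2 y = 0 \<and> br y y = 0 \<and>
     \<omega> x1 x2 = 1 \<and> \<omega> y y = 0"
proof -
  define s :: "complex \<Rightarrow> complex \<times> complex \<times> complex \<Rightarrow> complex \<times> complex \<times> complex"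
    where "s = (\<lambda>k (a, b, c). (k * a, k * b, k * c))"
  define g :: "bit \<Rightarrow> (complex \<times> complex \<times> complex) set"
    where "g = (\<lambda>\<alpha>. if \<alpha> = 0 then {(a, b, c). c = 0} else {(a, b, c). a = 0 \<and> b = 0})"
  define br :: "complex \<times> complex \<times> complex \<Rightarrow> complex \<times> complex \<times> complex \<Rightarrow> complex \<times> complex \<times> complex"
    where "br = (\<lambda>(a, b, c) (a', b', c'). (a * b' - b * a', 0, a * c' - c * a'))"
  define \<omega> :: "complex \<times> complex \<times> complex \<Rightarrow> complex \<times> complex \<times> complex \<Rightarrow> complex"
    where "\<omega> = (\<lambda>(a, b, c) (a', b', c'). a * b' - b * a')"
  interpret s: vector_space s
    by unfold_locales (auto simp: s_def algebra_simps)
  have vs: "vector_space s" by (rule s.vector_space_axioms)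
  have vs1: "vector_space ((*) :: complex \<Rightarrow> _)"
    by unfold_locales (auto simp: algebra_simps)
  have lin: "Vector_Spaces.linear s s f"
    if "\<And>x y. f (x + y) = f x + f y" "\<And>k x. f (s k x) = s k (f x)" for f
    using vs that by (simp add: Vector_Spaces.linear_iff)
  have lin1: "Vector_Spaces.linear s (*) f"
    if "\<And>x y. f (x + y) = f x + f y" "\<And>k x. f (s k x) = k * f x" for f
    using vs vs1 that by (simp add: Vector_Spaces.linear_iff)
  have "omega_Lie_superalgebra s g br \<omega>"
  proof (unfold_locales, goal_cases)
    case (1 \<alpha>)
    show ?case unfolding s.subspace_def by (auto simp: g_def s_def zero_prod_def)
  next
    case 2
    show ?case by (auto simp: g_def zero_prod_def)
  next
    case (3 x)
    obtain a b c where "x = (a, b, c)" by (cases x)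
    then show ?case
      by (intro bexI[of _ "(a, b, 0)"] bexI[of _ "(0, 0, c)"]) (auto simp: g_def)
  next
    case 4
    show ?case unfolding bilinear_map_def
      by (intro conjI allI lin) (auto simp: br_def s_def algebra_simps split: prod.splits)
  next
    case 5
    show ?case unfolding bilinear_map_def
      by (intro conjI allI lin1) (auto simp: \<omega>_def s_def algebra_simps split: prod.splits)
  next
    case (6 x \<alpha> y \<beta>)
    then show ?case
      by (cases \<alpha>; cases \<beta>) (auto simp: g_def br_def split: prod.splits)
  next
    case (7 x \<alpha> y \<beta>)
    then show ?case
      by (cases \<alpha>; cases \<beta>)
        (auto simp: g_def br_def s_def koszul_def zero_prod_def split: prod.splits)
  next
    case (8 x \<alpha> y \<beta> z \<gamma>)
    obtain a b c where x: "x = (a, b, c)" by (cases x)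
    obtain a' b' c' where y: "y = (a', b', c')" by (cases y)
    obtain a'' b'' c'' where z: "z = (a'', b'', c'')" by (cases z)
    show ?case
      using 8 unfolding x y z
      by (cases \<alpha>; cases \<beta>; cases \<gamma>)
        (simp_all add: g_def br_def s_def \<omega>_def koszul_def algebra_simps)
  next
    case (9 x y)
    then show ?case by (auto simp: g_def \<omega>_def)
  qed
  moreover have "ordered_basis s [(1, 0, 0), (0, 1, 0), (0, 0, 1)]"
  proof -
    let ?S = "{(1, 0, 0), (0, 1, 0), (0, 0, 1)} :: (complex \<times> complex \<times> complex) set"
    have "x \<in> s.span ?S" for x
    proof -
      obtain a b c where x: "x = (a, b, c)" by (cases x)
      have "s a (1, 0, 0) + (s b (0, 1, 0) + s c (0, 0, 1)) \<in> s.span ?S"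
        by (intro s.span_add s.span_scale s.span_base) auto
      then show ?thesis by (simp add: x s_def)
    qed
    moreover have "\<not> s.dependent ?S"
      by (subst s.dependent_finite) (auto simp: s_def zero_prod_def)
    ultimately show ?thesis by (auto simp: ordered_basis_def)
  qed
  ultimately show ?thesis
    by (intro exI[of _ s] exI[of _ g] exI[of _ br] exI[of _ \<omega>] exI[of _ "(1, 0, 0)"]
          exI[of _ "(0, 1, 0)"] exI[of _ "(0, 0, 1)"])
      (auto simp: g_def br_def \<omega>_def zero_prod_def)
qed

end

(* Evaluating the identities on pairs of basis vectors determines the generators.  An even one has
   d x1 = a x1 + s x2, d x2 = - a x2, d y = b y: compatibility at (x1, x2) makes the trace on the even
   part zero, and the derivation identity at (x2, y) removes the x1-component of d x2.  An odd one
   has d x1 = t y, d x2 = u y, d y = 0, by compatibility alone.  Hence every element of the span is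
   lower triangular with diagonal (a, -a, b), and its Jordan form is found by distinguishing which
   eigenvalues coincide and which off-diagonal entries survive. *)

theory Submission
  imports Defs
begin

section \<open>Coordinates with respect to a basis of three vectors\<close>

locale ordered_triple = vector_space scale
  for scale :: "complex \<Rightarrow> 'v::ab_group_add \<Rightarrow> 'v" +
  fixes e1 e2 e3 :: 'v
  assumes basis: "ordered_basis scale [e1, e2, e3]"
begin

definition comb :: "complex \<Rightarrow> complex \<Rightarrow> complex \<Rightarrow> 'v" where
  "comb p q r = scale p e1 + scale q e2 + scale r e3"

lemma comb_add: "comb p q r + comb p' q' r' = comb (p + p') (q + q') (r + r')"
  by (simp add: comb_def algebra_simps)

lemma comb_scale: "scale k (comb p q r) = comb (k * p) (k * q) (k * r)"
  by (simp add: comb_def algebra_simps)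

lemma comb_basis: "comb 1 0 0 = e1" "comb 0 1 0 = e2" "comb 0 0 1 = e3" "comb 0 0 0 = 0"
  by (simp_all add: comb_def)

lemma basis_facts:
  "distinct [e1, e2, e3]" "independent {e1, e2, e3}" "span {e1, e2, e3} = UNIV"
  using basis by (simp_all add: ordered_basis_def)

lemma representation_comb:
  "representation {e1, e2, e3} (comb p q r) =
     (\<lambda>b. (if b = e1 then p else 0) + (if b = e2 then q else 0) + (if b = e3 then r else 0))"
  using basis_facts
  by (auto simp: comb_def representation_add representation_scale representation_basis
      fun_eq_iff)

lemma comb_eq_iff: "comb p q r = comb p' q' r' \<longleftrightarrow> p = p' \<and> q = q' \<and> r = r'"
proof
  assume "comb p q r = comb p' q' r'"
  then have *: "representation {e1, e2, e3} (comb p q r) b =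
      representation {e1, e2, e3} (comb p' q' r') b" for b
    by simp
  show "p = p' \<and> q = q' \<and> r = r'"
    using *[of e1] *[of e2] *[of e3] basis_facts(1)
    by (auto simp: representation_comb)
qed simp

lemma comb_exhaust:
  obtains p q r where "v = comb p q r"
proof -
  have "v \<in> span {e1, e2, e3}" by (simp add: basis_facts)
  then obtain p q r where "v - scale p e1 - scale q e2 - scale r e3 = 0"
    by (auto simp: span_insert)
  then have "v = comb p q r" by (simp add: comb_def algebra_simps)
  then show thesis by (rule that)
qed

text \<open>The space has dimension 3, so a spanning list of length 3 has no repetitions, and a
  spanning set with as many elements as the dimension is independent.\<close>

lemma ordered_basis_if_span:
  assumes "length cs = 3" "e1 \<in> span (set cs)" "e2 \<in> span (set cs)" "e3 \<in> span (set cs)"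
  shows "ordered_basis scale cs"
proof -
  interpret fd: finite_dimensional_vector_space scale "{e1, e2, e3}"
    by unfold_locales (simp_all add: basis_facts)
  have dim: "dim (UNIV :: 'v set) = 3"
    using basis_facts dim_eq_card[of "{e1, e2, e3}" UNIV] by simp
  have "span {e1, e2, e3} \<subseteq> span (set cs)"
    by (rule span_minimal) (use assms in simp_all)
  then have span: "span (set cs) = UNIV" by (auto simp: basis_facts)
  then have "3 \<le> card (set cs)"
    using dim_le_card[of UNIV "set cs"] dim by simp
  moreover have "card (set cs) \<le> 3" using card_length[of cs] assms by simp
  ultimately have card: "card (set cs) = 3" by simp
  then have "distinct cs" using assms by (simp add: card_distinct)
  moreover have "independent (set cs)"
    by (rule fd.card_le_dim_spanning[of _ UNIV]) (use basis_facts(1) in \<open>simp_all add: span card dim\<close>)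
  ultimately show ?thesis by (simp add: ordered_basis_def span)
qed

text \<open>Cramer's rule: the assumption concerns the determinant of the coordinate rows.
  Multiplied by it, each of \<open>e1\<close>, \<open>e2\<close>, \<open>e3\<close> is a combination
  of the three vectors whose coefficients are the cofactors of one column.\<close>

lemma ordered_basis_comb:
  assumes det: "p * (q' * r'' - q'' * r') - q * (p' * r'' - p'' * r') + r * (p' * q'' - p'' * q') \<noteq> 0"
  shows "ordered_basis scale [comb p q r, comb p' q' r', comb p'' q'' r'']"
proof -
  define D where
    "D = p * (q' * r'' - q'' * r') - q * (p' * r'' - p'' * r') + r * (p' * q'' - p'' * q')"
  have D: "D \<noteq> 0" using det by (simp add: D_def)
  let ?S = "set [comb p q r, comb p' q' r', comb p'' q'' r'']"
  have in_span: "v \<in> span ?S"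
    if "scale D v = scale k1 (comb p q r) + scale k2 (comb p' q' r') + scale k3 (comb p'' q'' r'')"
    for v k1 k2 k3
  proof -
    have "scale (1 / D) (scale D v) \<in> span ?S"
      unfolding that by (intro span_scale span_add span_base) auto
    then show ?thesis using D by simp
  qed
  show ?thesis
  proof (rule ordered_basis_if_span)
    have "scale D (comb 1 0 0) = scale (q' * r'' - q'' * r') (comb p q r)
        + scale (q'' * r - q * r'') (comb p' q' r') + scale (q * r' - q' * r) (comb p'' q'' r'')"
      unfolding comb_add comb_scale comb_eq_iff D_def by (intro conjI) (simp_all add: algebra_simps)
    then show "e1 \<in> span ?S" by (intro in_span) (simp add: comb_basis)
    have "scale D (comb 0 1 0) = scale (r' * p'' - r'' * p') (comb p q r)
        + scale (r'' * p - r * p'') (comb p' q' r') + scale (r * p' - r' * p) (comb p'' q'' r'')"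
      unfolding comb_add comb_scale comb_eq_iff D_def by (intro conjI) (simp_all add: algebra_simps)
    then show "e2 \<in> span ?S" by (intro in_span) (simp add: comb_basis)
    have "scale D (comb 0 0 1) = scale (p' * q'' - p'' * q') (comb p q r)
        + scale (p'' * q - p * q'') (comb p' q' r') + scale (p * q' - p' * q) (comb p'' q'' r'')"
      unfolding comb_add comb_scale comb_eq_iff D_def by (intro conjI) (simp_all add: algebra_simps)
    then show "e3 \<in> span ?S" by (intro in_span) (simp add: comb_basis)
  qed simp
qed

text \<open>All four target matrices are lower bidiagonal, so this shape with free \<open>e\<close>
  and \<open>f\<close> serves every case.\<close>

lemma matrix_wrt_bidiagonal:
  assumes "d e1 = comb a e 0" "d e2 = comb 0 b f" "d e3 = comb 0 0 c"
  shows "matrix_wrt scale [e1, e2, e3] d = mat_of_rows_list 3 [[a, 0, 0], [e, b, 0], [0, f, c]]"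
  using basis_facts(1)
  by (intro eq_matI)
    (auto simp: matrix_wrt_def mat_of_rows_list_def less_Suc_eq numeral_3_eq_3 assms
      representation_comb[simplified] nth_Cons')

end

section \<open>Jordan forms of size three\<close>

lemma lower_jordan_matrix_diagonal:
  "lower_jordan_matrix (mat_of_rows_list 3 [[a, 0, 0], [0, b, 0], [0, 0, c]])"
  unfolding lower_jordan_matrix_def
  by (intro exI[of _ "[(1, a), (1, b), (1, c)]"] conjI eq_matI)
    (auto simp: mat_of_rows_list_def jordan_matrix_Cons jordan_matrix_def jordan_block_def
      less_Suc_eq numeral_3_eq_3 numeral_2_eq_2)

lemma lower_jordan_matrix_2_1:
  "lower_jordan_matrix (mat_of_rows_list 3 [[a, 0, 0], [1, a, 0], [0, 0, c]])"
  unfolding lower_jordan_matrix_def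
  by (intro exI[of _ "[(2, a), (1, c)]"] conjI eq_matI)
    (auto simp: mat_of_rows_list_def jordan_matrix_Cons jordan_matrix_def jordan_block_def
      less_Suc_eq numeral_3_eq_3 numeral_2_eq_2)

lemma lower_jordan_matrix_3:
  "lower_jordan_matrix (mat_of_rows_list 3 [[a, 0, 0], [1, a, 0], [0, 1, a]])"
  unfolding lower_jordan_matrix_def
  by (intro exI[of _ "[(3, a)]"] conjI eq_matI)
    (auto simp: mat_of_rows_list_def jordan_matrix_Cons jordan_matrix_def jordan_block_def
      less_Suc_eq numeral_3_eq_3 numeral_2_eq_2)

text \<open>Stated outside the locale so that coordinates can be taken with respect to
  \<open>u\<close>, \<open>v\<close>, \<open>w\<close> instead of the original basis.\<close>

lemma jordan_standard_form_bidiagonal: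
  assumes "vector_space scale" "ordered_basis scale [u, v, w]"
    and "d u = scale a u + scale e v" "d v = scale b v + scale f w" "d w = scale c w"
    and "lower_jordan_matrix (mat_of_rows_list 3 [[a, 0, 0], [e, b, 0], [0, f, c]])"
  shows "jordan_standard_form scale d (mat_of_rows_list 3 [[a, 0, 0], [e, b, 0], [0, f, c]])"
proof -
  interpret vector_space scale by fact
  interpret ordered_triple scale u v w by unfold_locales fact
  have "matrix_wrt scale [u, v, w] d = mat_of_rows_list 3 [[a, 0, 0], [e, b, 0], [0, f, c]]"
    by (rule matrix_wrt_bidiagonal) (simp_all add: assms comb_def)
  then show ?thesis using assms unfolding jordan_standard_form_def by blast
qed

section \<open>Jordan chains in coordinates\<close>

context ordered_triple
begin

lemma jordan_standard_form_comb:
  assumes "p * (q' * r'' - q'' * r') - q * (p' * r'' - p'' * r') + r * (p' * q'' - p'' * q') \<noteq> 0"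
    and "d (comb p q r) = scale a (comb p q r) + scale e (comb p' q' r')"
    and "d (comb p' q' r') = scale b (comb p' q' r') + scale f (comb p'' q'' r'')"
    and "d (comb p'' q'' r'') = scale c (comb p'' q'' r'')"
    and "lower_jordan_matrix (mat_of_rows_list 3 [[a, 0, 0], [e, b, 0], [0, f, c]])"
  shows "jordan_standard_form scale d (mat_of_rows_list 3 [[a, 0, 0], [e, b, 0], [0, f, c]])"
  by (rule jordan_standard_form_bidiagonal
      [OF vector_space_axioms ordered_basis_comb[OF assms(1)] assms(2-5)])

text \<open>For \<open>a \<noteq> 0\<close> the eigenvalues \<open>a\<close> and \<open>- a\<close>
  differ, so a block of size 2 requires \<open>b\<close> to be one of them, and the other is left as
  the last entry of form (2). For \<open>a = 0\<close> the eigenvalue 0 is repeated, and a block of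
  size 3 requires \<open>b = 0\<close> as well.\<close>

lemma jordan_standard_form_lower_triangular:
  assumes d: "\<And>p q r. d (comb p q r) = comb (a * p) (s * p - a * q) (t * p + u * q + b * r)"
  shows "(\<exists>a b. jordan_standard_form scale d
             (mat_of_rows_list 3 [[a, 0, 0], [0, - a, 0], [0, 0, b]])) \<or>
         (\<exists>a. jordan_standard_form scale d
             (mat_of_rows_list 3 [[a, 0, 0], [1, a, 0], [0, 0, - a]])) \<or>
         (\<exists>c. c \<noteq> 0 \<and> jordan_standard_form scale d
             (mat_of_rows_list 3 [[0, 0, 0], [1, 0, 0], [0, 0, c]])) \<or>
         jordan_standard_form scale d
             (mat_of_rows_list 3 [[0, 0, 0], [1, 0, 0], [0, 1, 0]])"
    (is "(\<exists>a b. ?J1 a b) \<or> (\<exists>a. ?J2 a) \<or> (\<exists>c. c \<noteq> 0 \<and> ?J3 c) \<or> ?J4")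
proof -
  note coords = d comb_add comb_scale comb_eq_iff
  note jordan = lower_jordan_matrix_diagonal lower_jordan_matrix_2_1 lower_jordan_matrix_3
  \<comment> \<open>Discharging the last premise fixes \<open>(e, f)\<close> as (0, 0), (1, 0) and
    (1, 1) respectively; a nonzero determinant and the chain equations remain.\<close>
  note form = jordan_standard_form_comb[OF _ _ _ _ jordan(1)]
    jordan_standard_form_comb[OF _ _ _ _ jordan(2)]
    jordan_standard_form_comb[OF _ _ _ _ jordan(3)]
  \<comment> \<open>If \<open>a \<noteq> 0\<close>, then \<open>d\<close> maps $v = e_1 + \frac{s}{2a} e_2$ to $a v + P e_3$; if \<open>a = 0 \<noteq> b\<close>, then
    $w = e_2 - \frac{u}{b} e_3$ lies in the kernel and \<open>d\<close> maps $e_1$ to $s w + Q e_3$.\<close>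
  define P where "P = t + s * u / (2 * a)"
  define Q where "Q = t + s * u / b"
  \<comment> \<open>When eigenvalues coincide, one coefficient decides whether the repeated one has
    a block of size 2: \<open>P\<close> for \<open>b = a\<close>, \<open>u\<close> for
    \<open>b = - a\<close>, and \<open>s\<close> for \<open>a = 0\<close> with
    \<open>b \<noteq> 0\<close>.\<close>
  consider "a \<noteq> 0" "b \<noteq> a" "b \<noteq> - a"
    | "a \<noteq> 0" "b = a" "P = 0" | "a \<noteq> 0" "b = a" "P \<noteq> 0"
    | "a \<noteq> 0" "b = - a" "u = 0" | "a \<noteq> 0" "b = - a" "u \<noteq> 0"
    | "a = 0" "b \<noteq> 0" "s = 0" | "a = 0" "b \<noteq> 0" "s \<noteq> 0"
    | "a = 0" "b = 0" "s \<noteq> 0" "u \<noteq> 0" | "a = 0" "b = 0" "s \<noteq> 0" "u = 0"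
    | "a = 0" "b = 0" "s = 0" "u \<noteq> 0"
    | "a = 0" "b = 0" "s = 0" "u = 0" "t \<noteq> 0" | "a = 0" "b = 0" "s = 0" "u = 0" "t = 0"
    by blast
  then show ?thesis
  proof cases
    case 1
    then have "a - b \<noteq> 0" "a + b \<noteq> 0" by (auto simp: eq_neg_iff_add_eq_0 add.commute)
    \<comment> \<open>The multiples of \<open>e3\<close> that turn \<open>v\<close> and
      \<open>e2\<close> into eigenvectors solve \<open>P + b * r = a * r\<close> and
      \<open>u + b * r' = - a * r'\<close>.\<close>
    with 1 have "?J1 a b"
      by (intro form(1)[where p = 1 and q = "s / (2 * a)" and r = "P / (a - b)" and
          p' = 0 and q' = 1 and r' = "- u / (a + b)" and
          p'' = 0 and q'' = 0 and r'' = 1])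
        (simp_all add: coords P_def divide_simps, simp_all add: algebra_simps)
    then show ?thesis by blast
  next
    case 2
    then have "?J1 a a"
      by (intro form(1)[where p = 1 and q = "s / (2 * a)" and r = 0 and
          p' = 0 and q' = 1 and r' = "- u / (2 * a)" and
          p'' = 0 and q'' = 0 and r'' = 1])
        (simp_all add: coords P_def divide_simps, simp_all add: algebra_simps)
    then show ?thesis by blast
  next
    case 3
    have "t + u * (s / (2 * a)) = P" "a * (s / (2 * a)) = s / 2"
      using 3 by (simp_all add: P_def)
    \<comment> \<open>The chain for \<open>a\<close> is \<open>v\<close>, \<open>P e3\<close>; the
      third vector is an eigenvector for \<open>- a\<close>.\<close>
    with 3 have "?J2 a"
      by (intro form(2)[where p = 1 and q = "s / (2 * a)" and r = 0 and
          p' = 0 and q' = 0 and r' = P and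
          p'' = 0 and q'' = 1 and r'' = "- u / (2 * a)"])
        (simp_all add: coords)
    then show ?thesis by blast
  next
    case 4
    then have "?J1 a (- a)"
      by (intro form(1)[where p = 1 and q = "s / (2 * a)" and r = "P / (2 * a)" and
          p' = 0 and q' = 1 and r' = 0 and
          p'' = 0 and q'' = 0 and r'' = 1])
        (simp_all add: coords P_def divide_simps)
    then show ?thesis by blast
  next
    case 5
    \<comment> \<open>Here the double eigenvalue is \<open>- a\<close>, with chain
      \<open>e2\<close>, \<open>u e3\<close>; the corrected \<open>v\<close> supplies the eigenvalue
      \<open>a\<close>.\<close>
    then have "?J2 (- a)"
      by (intro form(2)[where p = 0 and q = 1 and r = 0 and
          p' = 0 and q' = 0 and r' = u and
          p'' = 1 and q'' = "s / (2 * a)" and r'' = "P / (2 * a)"])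
        (simp_all add: coords P_def divide_simps)
    then show ?thesis by blast
  next
    case 6
    then have "?J1 0 b"
      by (intro form(1)[where p = 1 and q = 0 and r = "- Q / b" and
          p' = 0 and q' = 1 and r' = "- u / b" and
          p'' = 0 and q'' = 0 and r'' = 1])
        (simp_all add: coords Q_def divide_simps)
    then show ?thesis by blast
  next
    case 7
    \<comment> \<open>Subtracting \<open>Q / b\<close> times \<open>e3\<close> from
      \<open>e1\<close> gives a vector that is mapped to \<open>s w\<close>, which lies in the
      kernel.\<close>
    then have "?J3 b"
      by (intro form(2)[where p = 1 and q = 0 and r = "- Q / b" and
          p' = 0 and q' = s and r' = "- s * u / b" and
          p'' = 0 and q'' = 0 and r'' = 1])
        (simp_all add: coords Q_def divide_simps)
    with 7 show ?thesis by blast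
  next
    case 8
    \<comment> \<open>From here on \<open>d\<close> is nilpotent. Its square sends \<open>e1\<close>
      to \<open>s * u\<close> times \<open>e3\<close>, so a single chain generated by
      \<open>e1\<close> exists exactly in this case.\<close>
    then have "?J4"
      by (intro form(3)[where p = 1 and q = 0 and r = 0 and
          p' = 0 and q' = s and r' = t and
          p'' = 0 and q'' = 0 and r'' = "s * u"]) (simp_all add: coords)
    then show ?thesis by blast
  next
    case 9
    then have "?J2 0"
      by (intro form(2)[where p = 1 and q = 0 and r = 0 and
          p' = 0 and q' = s and r' = t and
          p'' = 0 and q'' = 0 and r'' = 1]) (simp_all add: coords)
    then show ?thesis by blast
  next
    case 10
    \<comment> \<open>The chain starts at \<open>e2\<close>, and \<open>t / u\<close> times
      \<open>e2\<close> is removed from \<open>e1\<close> to reach the kernel.\<close>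
    then have "?J2 0"
      by (intro form(2)[where p = 0 and q = 1 and r = 0 and
          p' = 0 and q' = 0 and r' = u and
          p'' = 1 and q'' = "- t / u" and r'' = 0]) (simp_all add: coords)
    then show ?thesis by blast
  next
    case 11
    then have "?J2 0"
      by (intro form(2)[where p = 1 and q = 0 and r = 0 and
          p' = 0 and q' = 0 and r' = t and
          p'' = 0 and q'' = 1 and r'' = 0]) (simp_all add: coords)
    then show ?thesis by blast
  next
    case 12
    then have "?J1 0 0"
      by (intro form(1)[where p = 1 and q = 0 and r = 0 and
          p' = 0 and q' = 1 and r' = 0 and
          p'' = 0 and q'' = 0 and r'' = 1]) (simp_all add: coords)
    then show ?thesis by blast
  qed
qed

end

section \<open>Compatible generalized derivations of $H$\<close>

locale omega_Lie_H = omega_Lie_superalgebra scale H br \<omega>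
  for scale :: "complex \<Rightarrow> 'v::ab_group_add \<Rightarrow> 'v" and H br \<omega> +
  fixes x1 x2 y :: 'v
  assumes ordered_basis_H: "ordered_basis scale [x1, x2, y]"
    and x1_even: "x1 \<in> H 0" and x2_even: "x2 \<in> H 0" and y_odd: "y \<in> H 1"
    and brackets: "br x1 x2 = x1" "br x1 y = y" "br x2 y = 0" "br y y = 0"
    and omega_x1_x2: "\<omega> x1 x2 = 1" and omega_y_y: "\<omega> y y = 0"
begin

sublocale ordered_triple scale x1 x2 y
  by unfold_locales (rule ordered_basis_H)

lemma bracket_linear:
  "br (v + w) z = br v z + br w z" "br v (w + z) = br v w + br v z"
  "br (scale k v) z = scale k (br v z)" "br v (scale k z) = scale k (br v z)"
  "br v 0 = 0" "br 0 v = 0"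
proof -
  interpret l: Vector_Spaces.linear scale scale "br v" for v
    using bilinear_bracket by (simp add: bilinear_map_def)
  interpret r: Vector_Spaces.linear scale scale "\<lambda>v. br v z" for z
    using bilinear_bracket by (simp add: bilinear_map_def)
  show "br (v + w) z = br v z + br w z" "br v (w + z) = br v w + br v z"
    "br (scale k v) z = scale k (br v z)" "br v (scale k z) = scale k (br v z)"
    "br v 0 = 0" "br 0 v = 0"
    by (simp_all add: l.add r.add l.scale r.scale l.zero r.zero)
qed

lemma omega_linear:
  "\<omega> (v + w) z = \<omega> v z + \<omega> w z" "\<omega> v (w + z) = \<omega> v w + \<omega> v z"
  "\<omega> (scale k v) z = k * \<omega> v z" "\<omega> v (scale k z) = k * \<omega> v z"
  "\<omega> v 0 = 0" "\<omega> 0 v = 0"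
proof -
  interpret l: Vector_Spaces.linear scale "(*)" "\<omega> v" for v
    using bilinear_form by (simp add: bilinear_map_def)
  interpret r: Vector_Spaces.linear scale "(*)" "\<lambda>v. \<omega> v z" for z
    using bilinear_form by (simp add: bilinear_map_def)
  show "\<omega> (v + w) z = \<omega> v z + \<omega> w z" "\<omega> v (w + z) = \<omega> v w + \<omega> v z"
    "\<omega> (scale k v) z = k * \<omega> v z" "\<omega> v (scale k z) = k * \<omega> v z"
    "\<omega> v 0 = 0" "\<omega> 0 v = 0"
    by (simp_all add: l.add r.add l.scale r.scale l.zero r.zero)
qed

lemma basis_nonzero: "x1 \<noteq> 0" "x2 \<noteq> 0" "y \<noteq> 0"
  using comb_eq_iff[of 1 0 0 0 0 0] comb_eq_iff[of 0 1 0 0 0 0] comb_eq_iff[of 0 0 1 0 0 0]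
  by (simp_all add: comb_basis)

lemma br_even_self: "x \<in> H 0 \<Longrightarrow> br x x = 0"
proof -
  assume "x \<in> H 0"
  then have "br x x = - br x x" using super_skew[of x 0 x 0] by (simp add: koszul_def)
  \<comment> \<open>Passing to complex coordinates makes it possible to divide by 2.\<close>
  moreover obtain p q r where "br x x = comb p q r" by (rule comb_exhaust)
  ultimately show ?thesis
    using comb_scale[of "-1" p q r] by (simp add: comb_eq_iff comb_basis)
qed

text \<open>In the Jacobi identity at \<open>(x, x, x)\<close> the brackets vanish, leaving three
  times \<open>\<omega> x x\<close> as the coefficient of a nonzero vector \<open>x\<close>.\<close>

lemma omega_even_self: "\<omega> x1 x1 = 0" "\<omega> x2 x2 = 0"
  using omega_Jacobi[of x1 0 x1 0 x1 0] omega_Jacobi[of x2 0 x2 0 x2 0] x1_even x2_even basis_nonzero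
  by (auto simp: koszul_def br_even_self bracket_linear simp flip: scale_left_distrib)

lemma comb_even: "comb p q 0 \<in> H 0"
proof -
  have "scale p x1 + scale q x2 \<in> H 0"
    by (intro subspace_add subspace_scale subspace_component x1_even x2_even)
  then show ?thesis by (simp add: comb_def)
qed

text \<open>The basis vectors are only assumed to lie in the components. The \<open>y\<close>-part
  of an even vector is even as a difference and odd as a multiple of \<open>y\<close>, hence zero;
  the odd case is symmetric.\<close>

lemma even_coordinates:
  assumes "v \<in> H 0"
  obtains p q where "v = comb p q 0"
proof -
  obtain p q r where v: "v = comb p q r" by (rule comb_exhaust)
  have "comb p q 0 \<in> H 0" by (rule comb_even)
  then have "v - comb p q 0 \<in> H 0" by (intro subspace_diff subspace_component assms)
  moreover have "v - comb p q 0 = scale r y" by (simp add: v comb_def)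
  moreover have "scale r y \<in> H 1" by (intro subspace_scale subspace_component y_odd)
  ultimately have "scale r y \<in> H 0 \<inter> H 1" by simp
  then have "scale r y = 0" unfolding components_disjoint by simp
  then have "v = comb p q 0" using basis_nonzero by (simp add: v)
  then show thesis by (rule that)
qed

lemma odd_coordinates:
  assumes "v \<in> H 1"
  obtains r where "v = comb 0 0 r"
proof -
  obtain p q r where v: "v = comb p q r" by (rule comb_exhaust)
  have "comb p q 0 \<in> H 0" by (rule comb_even)
  moreover have "comb p q 0 = v - scale r y" by (simp add: v comb_def)
  moreover have "v - scale r y \<in> H 1"
    by (intro subspace_diff subspace_scale subspace_component y_odd assms)
  ultimately have "comb p q 0 \<in> H 0 \<inter> H 1" by simp
  then have "comb p q 0 = comb 0 0 0" unfolding components_disjoint comb_basis by simp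
  then have "v = comb 0 0 r" by (simp add: v comb_eq_iff)
  then show thesis by (rule that)
qed

section \<open>Shape of the compatible generators and of their span\<close>

lemma linear_comb:
  assumes "Vector_Spaces.linear scale scale d"
  shows "d (comb p q r) = scale p (d x1) + scale q (d x2) + scale r (d y)"
proof -
  interpret d: Vector_Spaces.linear scale scale d by fact
  show ?thesis by (simp add: comb_def d.add d.scale)
qed

text \<open>One five-parameter shape covers both degrees, so that mixed sums keep it: even
  generators have \<open>t = u = 0\<close>, odd ones \<open>a = s = b = 0\<close>.\<close>

lemma generator_lower_triangular:
  assumes gd: "generalized_derivation scale H br \<delta> d" and compat: "omega_compatible H \<omega> \<delta> d"
  shows "\<exists>a s t u b. \<forall>p q r. d (comb p q r) = comb (a * p) (s * p - a * q) (t * p + u * q + b * r)"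
proof -
  have lin: "Vector_Spaces.linear scale scale d"
    and deg: "\<And>\<alpha> x. x \<in> H \<alpha> \<Longrightarrow> d x \<in> H (\<delta> + \<alpha>)"
    using gd by (auto simp: generalized_derivation_def homogeneous_map_def)
  from gd obtain d' d'' where
    d': "homogeneous_map scale H \<delta> d'" and d'': "homogeneous_map scale H \<delta> d''" and
    gen: "\<And>\<alpha> v w. v \<in> H \<alpha> \<Longrightarrow> d'' (br v w) = br (d v) w + scale (koszul \<delta> \<alpha>) (br v (d' w))"
    unfolding generalized_derivation_def by blast
  have compat: "\<And>\<alpha> v w. v \<in> H \<alpha> \<Longrightarrow> \<omega> (d v) w + koszul \<delta> \<alpha> * \<omega> v (d w) = 0"
    using compat by (auto simp: omega_compatible_def)
  note coords = comb_def bracket_linear omega_linear brackets omega_x1_x2 omega_y_y omega_even_self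
    omega_even_odd x1_even x2_even y_odd koszul_def
  show ?thesis
  proof (cases "\<delta> = 0")
    case True
    obtain a s where dx1: "d x1 = comb a s 0"
      using deg[OF x1_even] True by (auto elim: even_coordinates)
    obtain k l where dx2: "d x2 = comb k l 0"
      using deg[OF x2_even] True by (auto elim: even_coordinates)
    obtain b where dy: "d y = comb 0 0 b"
      using deg[OF y_odd] True by (auto elim: odd_coordinates)
    have "d' y \<in> H (\<delta> + 1)" using d' y_odd unfolding homogeneous_map_def by blast
    then have "d' y \<in> H 1" using True by simp
    then obtain c where d'y: "d' y = comb 0 0 c" by (rule odd_coordinates)
    have "d'' 0 = 0"
    proof -
      interpret d'': Vector_Spaces.linear scale scale d''
        using d'' by (simp add: homogeneous_map_def)
      show ?thesis by (rule d''.zero)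
    qed
    \<comment> \<open>Since \<open>d' y\<close> is a multiple of \<open>y\<close>, its bracket with
      \<open>x2\<close> vanishes, and only \<open>br (d x2) y = scale k y\<close> is left.\<close>
    then have "scale k y = 0"
      using gen[OF x2_even, of y] by (simp add: dx2 d'y coords)
    then have k: "k = 0" using basis_nonzero by simp
    have "l = - a"
      using compat[OF x1_even, of x2] True k by (simp add: dx1 dx2 coords eq_neg_iff_add_eq_0 add.commute)
    with k have "d (comb p q r) = comb (a * p) (s * p - a * q) (0 * p + 0 * q + b * r)" for p q r
      unfolding linear_comb[OF lin] dx1 dx2 dy comb_scale comb_add
      by (simp add: comb_eq_iff algebra_simps)
    then show ?thesis by blast
  next
    case False
    then have \<delta>: "\<delta> = 1" by simp
    obtain t where dx1: "d x1 = comb 0 0 t"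
      using deg[OF x1_even] \<delta> by (auto elim: odd_coordinates)
    obtain u where dx2: "d x2 = comb 0 0 u"
      using deg[OF x2_even] \<delta> by (auto elim: odd_coordinates)
    obtain k l where dy: "d y = comb k l 0"
      using deg[OF y_odd] \<delta> by (auto elim: even_coordinates)
    \<comment> \<open>The pairs \<open>(x1, y)\<close> and \<open>(y, x2)\<close> isolate the two
      coordinates of \<open>d y\<close> through the given value \<open>\<omega> x1 x2 = 1\<close>;
      the other terms contain \<open>\<omega> y y\<close> or \<open>\<omega> x1 x1\<close>, or the
      coefficient \<open>l\<close> already shown to be 0.\<close>
    have l: "l = 0" using compat[OF x1_even, of y] by (simp add: dx1 dy coords)
    have k: "k = 0" using compat[OF y_odd, of x2] l by (simp add: dx2 dy coords)
    have "d (comb p q r) = comb (0 * p) (0 * p - 0 * q) (t * p + u * q + 0 * r)" for p q r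
      unfolding linear_comb[OF lin] dx1 dx2 dy comb_scale comb_add k l
      by (simp add: comb_eq_iff algebra_simps)
    then show ?thesis by blast
  qed
qed

lemma GDer_omega_lower_triangular:
  assumes "d \<in> GDer_omega scale H br \<omega>"
  shows "\<exists>a s t u b. \<forall>p q r. d (comb p q r) = comb (a * p) (s * p - a * q) (t * p + u * q + b * r)"
proof -
  interpret F: Modules.module "\<lambda>c (f :: 'v \<Rightarrow> 'v) x. scale c (f x)"
    by unfold_locales (simp_all add: fun_eq_iff algebra_simps)
  \<comment> \<open>Indexing by the parameters makes closure explicit: they add under sums and scale
    under multiples.\<close>
  define T where "T a s t u b = {d. \<forall>p q r.
      d (comb p q r) = comb (a * p) (s * p - a * q) (t * p + u * q + b * r)}" for a s t u b
  have add: "f + h \<in> T (a + a') (s + s') (t + t') (u + u') (b + b')"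
    if "f \<in> T a s t u b" "h \<in> T a' s' t' u' b'" for f h a s t u b a' s' t' u' b'
    using that by (simp add: T_def comb_add comb_eq_iff algebra_simps)
  have scale: "(\<lambda>x. scale c (f x)) \<in> T (c * a) (c * s) (c * t) (c * u) (c * b)"
    if "f \<in> T a s t u b" for f c a s t u b
    using that by (simp add: T_def comb_scale comb_eq_iff algebra_simps)
  have zero: "0 \<in> T 0 0 0 0 0" by (simp add: T_def comb_basis)
  have "F.subspace {d. \<exists>a s t u b. d \<in> T a s t u b}"
  proof (rule F.subspaceI, goal_cases)
    case 1
    show ?case using zero by blast
  next
    case (2 f h)
    then show ?case using add by blast
  next
    case (3 c f)
    then obtain a s t u b where "f \<in> T a s t u b" by blast
    from scale[OF this, of c] show ?case by blast
  qed
  moreover have "{d. \<exists>\<delta>. generalized_derivation scale H br \<delta> d \<and> omega_compatible H \<omega> \<delta> d}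
      \<subseteq> {d. \<exists>a s t u b. d \<in> T a s t u b}"
    using generator_lower_triangular by (auto simp: T_def)
  ultimately have "GDer_omega scale H br \<omega> \<subseteq> {d. \<exists>a s t u b. d \<in> T a s t u b}"
    unfolding GDer_omega_def by (intro F.span_minimal)
  then show ?thesis using assms by (auto simp: T_def)
qed

end

theorem proposition5p2:
  fixes scale :: "complex \<Rightarrow> 'v::ab_group_add \<Rightarrow> 'v"
    and H :: "bit \<Rightarrow> 'v set"
    and br :: "'v \<Rightarrow> 'v \<Rightarrow> 'v"
    and \<omega> :: "'v \<Rightarrow> 'v \<Rightarrow> complex"
    and x1 x2 y :: 'v
    and d :: "'v \<Rightarrow> 'v"
  assumes "omega_Lie_superalgebra scale H br \<omega>"
    and "ordered_basis scale [x1, x2, y]"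
    and "x1 \<in> H 0" and "x2 \<in> H 0" and "y \<in> H 1"
    and "br x1 x2 = x1" and "br x1 y = y" and "br x2 y = 0" and "br y y = 0"
    and "\<omega> x1 x2 = 1" and "\<omega> y y = 0"
    and "d \<in> GDer_omega scale H br \<omega>"
  shows "(\<exists>a b. jordan_standard_form scale d
             (mat_of_rows_list 3 [[a, 0, 0], [0, - a, 0], [0, 0, b]])) \<or>
         (\<exists>a. jordan_standard_form scale d
             (mat_of_rows_list 3 [[a, 0, 0], [1, a, 0], [0, 0, - a]])) \<or>
         (\<exists>c. c \<noteq> 0 \<and> jordan_standard_form scale d
             (mat_of_rows_list 3 [[0, 0, 0], [1, 0, 0], [0, 0, c]])) \<or>
         jordan_standard_form scale d
             (mat_of_rows_list 3 [[0, 0, 0], [1, 0, 0], [0, 1, 0]])"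
proof -
  interpret omega_Lie_superalgebra scale H br \<omega> by fact
  interpret omega_Lie_H scale H br \<omega> x1 x2 y
    by unfold_locales fact+
  from GDer_omega_lower_triangular[OF assms(12)] obtain a s t u b where
    "\<And>p q r. d (comb p q r) = comb (a * p) (s * p - a * q) (t * p + u * q + b * r)"
    by blast
  then show ?thesis by (rule jordan_standard_form_lower_triangular)
qed

end
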